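(* Let $\overline{Q}$ be a bounded sublinear rate operator on $\mathscr{B}$ and let $t\in\mathbb{R}_{\ge 0}$. Then the sequence $\bigl((I+\frac{t}{n}\overline{Q})^n\bigr)_{n\in\mathbb{N}}$ of bounded operators is Cauchy (with respect to $\|\cdot\|_{\mathrm b}$), and its limit $$e^{t\overline{Q}}:=\lim_{n\to+\infty}\Bigl(I+\frac{t}{n}\overline{Q}\Bigr)^n$$ is a sublinear transition operator.
   Context: Let $\mathcal{X}$ be a nonempty countable (finite or countably infinite) set and let $\mathscr{B}$ be the real vector space of bounded functions $\mathcal{X}\to\mathbb{R}$, with norm $\|f\|_\infty=\sup\{|f(x)|: x\in\mathcal{X}\}$. Inequalities between functions are pointwise and a real number is identified with the corresponding constant function. An operator is a (possibly nonlinear) map $\mathscr{B}\to\mathscr{B}$; $I$ is the identity operator; sums and real multiples of operators are defined pointwise, products and powers are compositions. For an operator $A$, $\|A\|_{\mathrm s}=\sup\{\|Af\|_\infty/\|f\|_\infty : f\in\mathscr{B}, f\ne 0\}$; $A$ is bounded if $\|A\|_{\mathrm s}<+\infty$. On the vector space of bounded operators one uses the norm $\|A\|_{\mathrm b}=\|A0\|_\infty+\|A\|_{\mathrm s}$, and limits of bounded operators are with respect to this norm. A sublinear transition operator is an operator $\overline{T}$ such that $\overline{T}(\lambda f)=\lambda\overline{T}f$ for all $f\in\mathscr{B}$ and real $\lambda\ge 0$; $\overline{T}(f+g)\le\overline{T}f+\overline{T}g$ for all $f,g\in\mathscr{B}$; and $\overline{T}f\le\sup f$ for all $f\in\mathscr{B}$.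 A sublinear rate operator is an operator $\overline{Q}$ such that $\overline{Q}(\lambda f)=\lambda\overline{Q}f$ for all $f\in\mathscr{B}$ and real $\lambda\ge 0$; $\overline{Q}(f+g)\le\overline{Q}f+\overline{Q}g$ for all $f,g\in\mathscr{B}$; $\overline{Q}\mu=0$ for all constants $\mu\in\mathbb{R}$; and $[\overline{Q}f](x)\le 0$ for all $f\in\mathscr{B}$ and $x\in\mathcal{X}$ with $\sup f=f(x)\ge 0$. *)

theory Defs
  imports "HOL-Analysis.Analysis"
begin

section \<open>Bounded real functions with the supremum norm\<close>

text \<open>The domain is a whole type; types are nonempty, and countability is imposed through the
  class \<open>countable\<close> (finite or countably infinite types) where it is assumed. The library type
  \<open>bcontfun\<close> is not used since it would tie the domain to the topology already
  attached to its type.\<close>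

typedef 'a bfun = "{f :: 'a \<Rightarrow> real. bounded (range f)}"
  morphisms apply_bfun Bfun
  by (rule exI[of _ "\<lambda>_. 0"]) auto

setup_lifting type_definition_bfun

lemma bounded_apply_bfun: "bounded (range (apply_bfun f))"
  using apply_bfun[of f] by simp

lemma bfun_eqI: "(\<And>x. apply_bfun f x = apply_bfun g x) \<Longrightarrow> f = g"
  by (simp add: apply_bfun_inject[symmetric] fun_eq_iff)

lift_definition const_bfun :: "real \<Rightarrow> 'a bfun" is "\<lambda>c _. c"
  by auto

instantiation bfun :: (type) real_vector
begin

lift_definition zero_bfun :: "'a bfun" is "\<lambda>_. 0"
  by auto

lift_definition uminus_bfun :: "'a bfun \<Rightarrow> 'a bfun" is "\<lambda>f x. - f x"
  by (auto simp: bounded_iff)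

lift_definition plus_bfun :: "'a bfun \<Rightarrow> 'a bfun \<Rightarrow> 'a bfun" is "\<lambda>f g x. f x + g x"
  by (rule bounded_plus_comp)

lift_definition minus_bfun :: "'a bfun \<Rightarrow> 'a bfun \<Rightarrow> 'a bfun" is "\<lambda>f g x. f x - g x"
  by (rule bounded_minus_comp)

lift_definition scaleR_bfun :: "real \<Rightarrow> 'a bfun \<Rightarrow> 'a bfun" is "\<lambda>c f x. c * f x"
proof -
  fix c :: real and f :: "'a \<Rightarrow> real"
  assume "bounded (range f)"
  from bounded_scaleR_comp[OF this, of c] show "bounded (range (\<lambda>x. c * f x))"
    by simp
qed

instance
  by standard (transfer; simp add: algebra_simps fun_eq_iff)+

end

lemma bdd_above_abs_bfun: "bdd_above (range (\<lambda>x. \<bar>apply_bfun f x\<bar>))"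
  using bounded_apply_bfun[of f] by (auto simp: bounded_iff bdd_above_def)

instantiation bfun :: (type) real_normed_vector
begin

definition norm_bfun :: "'a bfun \<Rightarrow> real"
  where "norm_bfun f = (SUP x. \<bar>apply_bfun f x\<bar>)"

definition dist_bfun :: "'a bfun \<Rightarrow> 'a bfun \<Rightarrow> real"
  where "dist_bfun f g = norm (f - g)"

definition sgn_bfun :: "'a bfun \<Rightarrow> 'a bfun"
  where "sgn_bfun f = f /\<^sub>R norm f"

definition uniformity_bfun :: "('a bfun \<times> 'a bfun) filter"
  where "uniformity_bfun = (INF e\<in>{0<..}. principal {(f, g). dist f g < e})"

definition open_bfun :: "'a bfun set \<Rightarrow> bool"
  where "open_bfun S = (\<forall>f\<in>S. \<forall>\<^sub>F (f', g) in uniformity. f' = f \<longrightarrow> g \<in> S)"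

instance
proof
  fix f g :: "'a bfun" and c :: real and S :: "'a bfun set"
  have le: "\<bar>apply_bfun h x\<bar> \<le> norm h" for h :: "'a bfun" and x
    unfolding norm_bfun_def by (rule cSUP_upper[OF UNIV_I bdd_above_abs_bfun])
  have least: "norm h \<le> b" if "\<And>x. \<bar>apply_bfun h x\<bar> \<le> b" for h :: "'a bfun" and b
    unfolding norm_bfun_def by (rule cSUP_least) (use that in auto)
  have pos: "0 \<le> norm h" for h :: "'a bfun"
    using le[of h undefined] by linarith
  show "dist f g = norm (f - g)" "sgn f = f /\<^sub>R norm f"
    by (simp_all add: dist_bfun_def sgn_bfun_def)
  show "(uniformity :: ('a bfun \<times> 'a bfun) filter) =
      (INF e\<in>{0<..}. principal {(f, g). dist f g < e})"
    by (rule uniformity_bfun_def)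
  show "open S \<longleftrightarrow> (\<forall>f\<in>S. \<forall>\<^sub>F (f', g) in uniformity. f' = f \<longrightarrow> g \<in> S)"
    by (rule open_bfun_def)
  show "norm f = 0 \<longleftrightarrow> f = 0"
  proof
    assume "norm f = 0"
    then have "apply_bfun f x = 0" for x
      using le[of f x] by simp
    then show "f = 0"
      by (intro bfun_eqI) (simp add: zero_bfun.rep_eq)
  next
    assume "f = 0"
    then have "norm f \<le> 0"
      by (intro least) (simp add: zero_bfun.rep_eq)
    then show "norm f = 0"
      using pos[of f] by simp
  qed
  show "norm (f + g) \<le> norm f + norm g"
  proof (rule least)
    fix x
    show "\<bar>apply_bfun (f + g) x\<bar> \<le> norm f + norm g"
      using le[of f x] le[of g x] by (simp add: plus_bfun.rep_eq)
  qed
  show "norm (c *\<^sub>R f) = \<bar>c\<bar> * norm f"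
  proof (rule antisym)
    show "norm (c *\<^sub>R f) \<le> \<bar>c\<bar> * norm f"
      by (rule least) (simp add: scaleR_bfun.rep_eq abs_mult le mult_left_mono)
    show "\<bar>c\<bar> * norm f \<le> norm (c *\<^sub>R f)"
    proof (cases "c = 0")
      case True
      then show ?thesis using pos[of "c *\<^sub>R f"] by simp
    next
      case False
      have "norm f \<le> norm (c *\<^sub>R f) / \<bar>c\<bar>"
      proof (rule least)
        fix x
        show "\<bar>apply_bfun f x\<bar> \<le> norm (c *\<^sub>R f) / \<bar>c\<bar>"
          using le[of "c *\<^sub>R f" x] False
          by (simp add: scaleR_bfun.rep_eq abs_mult field_simps)
      qed
      then show ?thesis using False by (simp add: field_simps)
    qed
  qed
qed

end


section \<open>Bounded operators\<close>

text \<open>An operator is an arbitrary map on bounded functions. The supremum is taken in the extended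
  reals, so that it exists (and may be infinite) for every operator.\<close>

definition op_norm_s :: "('a bfun \<Rightarrow> 'a bfun) \<Rightarrow> ereal"
  where "op_norm_s A = (SUP f\<in>{f. f \<noteq> 0}. ereal (norm (A f) / norm f))"

definition bounded_operator :: "('a bfun \<Rightarrow> 'a bfun) \<Rightarrow> bool"
  where "bounded_operator A \<longleftrightarrow> op_norm_s A < \<infinity>"

text \<open>Only meaningful on bounded operators: the conversion sends \<open>\<infinity>\<close> to 0.\<close>

definition op_norm_b :: "('a bfun \<Rightarrow> 'a bfun) \<Rightarrow> real"
  where "op_norm_b A = norm (A 0) + real_of_ereal (op_norm_s A)"

definition op_dist :: "('a bfun \<Rightarrow> 'a bfun) \<Rightarrow> ('a bfun \<Rightarrow> 'a bfun) \<Rightarrow> real"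
  where "op_dist A B = op_norm_b (\<lambda>f. A f - B f)"

lemma op_norm_s_upper: "f \<noteq> 0 \<Longrightarrow> ereal (norm (A f) / norm f) \<le> op_norm_s A"
  unfolding op_norm_s_def by (rule SUP_upper) simp

lemma op_norm_s_least:
  "(\<And>f. f \<noteq> 0 \<Longrightarrow> ereal (norm (A f) / norm f) \<le> b) \<Longrightarrow> op_norm_s A \<le> b"
  unfolding op_norm_s_def by (rule SUP_least) simp

lemma op_norm_s_nonneg: "0 \<le> op_norm_s (A :: 'a bfun \<Rightarrow> 'a bfun)"
proof -
  have "apply_bfun (const_bfun 1 :: 'a bfun) undefined \<noteq> apply_bfun 0 undefined"
    by (simp add: const_bfun.rep_eq zero_bfun.rep_eq)
  then have "(const_bfun 1 :: 'a bfun) \<noteq> 0"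
    by metis
  from op_norm_s_upper[OF this, of A] show ?thesis
    by (rule order_trans[rotated]) simp
qed

lemma op_norm_s_ereal: "bounded_operator A \<Longrightarrow> ereal (real_of_ereal (op_norm_s A)) = op_norm_s A"
  using op_norm_s_nonneg[of A] by (auto simp: bounded_operator_def ereal_real)

lemma op_norm_s_add: "op_norm_s (\<lambda>f. A f + B f) \<le> op_norm_s A + op_norm_s B"
proof (rule op_norm_s_least)
  fix f :: "'a bfun" assume f: "f \<noteq> 0"
  have "norm (A f + B f) / norm f \<le> norm (A f) / norm f + norm (B f) / norm f"
    by (simp add: add_divide_distrib[symmetric] divide_right_mono norm_triangle_ineq)
  then have "ereal (norm (A f + B f) / norm f) \<le> ereal (norm (A f) / norm f) + ereal (norm (B f) / norm f)"
    by simp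
  also have "\<dots> \<le> op_norm_s A + op_norm_s B"
    by (intro add_mono op_norm_s_upper f)
  finally show "ereal (norm (A f + B f) / norm f) \<le> op_norm_s A + op_norm_s B" .
qed

lemma op_norm_s_minus: "op_norm_s (\<lambda>f. - A f) = op_norm_s A"
  by (simp add: op_norm_s_def)

lemma bounded_operator_add:
  "bounded_operator A \<Longrightarrow> bounded_operator B \<Longrightarrow> bounded_operator (\<lambda>f. A f + B f)"
  using op_norm_s_add[of A B] by (auto simp: bounded_operator_def)

lemma bounded_operator_diff:
  assumes "bounded_operator A" "bounded_operator B" shows "bounded_operator (\<lambda>f. A f - B f)"
  using bounded_operator_add[of A "\<lambda>f. - B f"] assms
  by (simp add: bounded_operator_def op_norm_s_minus)

lemma op_norm_b_add:
  assumes "bounded_operator A" "bounded_operator B"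
  shows "op_norm_b (\<lambda>f. A f + B f) \<le> op_norm_b A + op_norm_b B"
proof -
  have "ereal (real_of_ereal (op_norm_s (\<lambda>f. A f + B f)))
      \<le> ereal (real_of_ereal (op_norm_s A) + real_of_ereal (op_norm_s B))"
    using op_norm_s_add[of A B] assms
    by (simp only: op_norm_s_ereal bounded_operator_add plus_ereal.simps(1)[symmetric])
  then show ?thesis
    using norm_triangle_ineq[of "A 0" "B 0"] by (simp add: op_norm_b_def)
qed

text \<open>Makes the Cauchy property \<open>bounded_ops.MCauchy\<close> and the topology \<open>bounded_ops.mtopology\<close> of
  the normed space of bounded operators available; both include membership in that space.\<close>

interpretation bounded_ops: Metric_space "Collect bounded_operator" op_dist
proof
  fix A B C :: "'a bfun \<Rightarrow> 'a bfun"
  show "0 \<le> op_dist A B"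
    by (simp add: op_dist_def op_norm_b_def op_norm_s_nonneg real_of_ereal_pos)
  show "op_dist A B = op_dist B A"
    by (simp add: op_dist_def op_norm_b_def op_norm_s_def norm_minus_commute)
  assume A: "A \<in> Collect bounded_operator" and B: "B \<in> Collect bounded_operator"
  show "op_dist A B = 0 \<longleftrightarrow> A = B"
  proof
    assume 0: "op_dist A B = 0"
    let ?D = "\<lambda>f. A f - B f"
    have D: "bounded_operator ?D"
      using A B by (simp add: bounded_operator_diff)
    have nn: "0 \<le> real_of_ereal (op_norm_s ?D)"
      by (simp add: op_norm_s_nonneg real_of_ereal_pos)
    have "norm (?D 0) = 0" and "real_of_ereal (op_norm_s ?D) = 0"
      using 0 nn norm_ge_zero[of "?D 0"] unfolding op_dist_def op_norm_b_def by linarith+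
    then have z: "A 0 = B 0" and s: "op_norm_s ?D = 0"
      using op_norm_s_ereal[OF D] by (simp_all add: zero_ereal_def)
    show "A = B"
    proof
      fix f show "A f = B f"
      proof (cases "f = 0")
        case False
        have "ereal (norm (?D f) / norm f) \<le> 0"
          using op_norm_s_upper[OF False, of ?D] s by simp
        then have "norm (?D f) / norm f \<le> 0"
          by simp
        then show ?thesis using False
          by (simp add: divide_le_0_iff)
      qed (simp add: z)
    qed
  next
    assume "A = B"
    moreover have "op_norm_s (\<lambda>f. 0 :: 'a bfun) \<le> 0"
      by (rule op_norm_s_least) simp
    ultimately show "op_dist A B = 0"
      using op_norm_s_nonneg[of "\<lambda>f. 0 :: 'a bfun"] by (simp add: op_dist_def op_norm_b_def)
  qed
  assume C: "C \<in> Collect bounded_operator"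
  show "op_dist A C \<le> op_dist A B + op_dist B C"
    using op_norm_b_add[of "\<lambda>f. A f - B f" "\<lambda>f. B f - C f"] A B C
    by (simp add: op_dist_def bounded_operator_diff)
qed


section \<open>Sublinear transition and rate operators\<close>

definition sublinear_transition_operator :: "('a bfun \<Rightarrow> 'a bfun) \<Rightarrow> bool"
  where "sublinear_transition_operator T \<longleftrightarrow>
    (\<forall>f c. 0 \<le> c \<longrightarrow> T (c *\<^sub>R f) = c *\<^sub>R T f) \<and>
    (\<forall>f g x. apply_bfun (T (f + g)) x \<le> apply_bfun (T f) x + apply_bfun (T g) x) \<and>
    (\<forall>f x. apply_bfun (T f) x \<le> (SUP y. apply_bfun f y))"

definition sublinear_rate_operator :: "('a bfun \<Rightarrow> 'a bfun) \<Rightarrow> bool"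
  where "sublinear_rate_operator Q \<longleftrightarrow>
    (\<forall>f c. 0 \<le> c \<longrightarrow> Q (c *\<^sub>R f) = c *\<^sub>R Q f) \<and>
    (\<forall>f g x. apply_bfun (Q (f + g)) x \<le> apply_bfun (Q f) x + apply_bfun (Q g) x) \<and>
    (\<forall>c. Q (const_bfun c) = 0) \<and>
    (\<forall>f x. (SUP y. apply_bfun f y) = apply_bfun f x \<and> 0 \<le> apply_bfun f x \<longrightarrow> apply_bfun (Q f) x \<le> 0)"

text \<open>The operator $(I + \frac{t}{n} Q)^n$; for \<open>n = 0\<close> it is the identity.\<close>

definition euler_operator :: "real \<Rightarrow> ('a bfun \<Rightarrow> 'a bfun) \<Rightarrow> nat \<Rightarrow> 'a bfun \<Rightarrow> 'a bfun"
  where "euler_operator t Q n = (\<lambda>f. f + (t / real n) *\<^sub>R Q f) ^^ n"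

text \<open>The limit is unique where it exists (metric spaces are Hausdorff); without a limit the value
  is unspecified, so existence has to be asserted alongside any use.\<close>

definition exp_operator :: "real \<Rightarrow> ('a bfun \<Rightarrow> 'a bfun) \<Rightarrow> 'a bfun \<Rightarrow> 'a bfun"
  where "exp_operator t Q = (THE L. limitin bounded_ops.mtopology (euler_operator t Q) L sequentially)"

end

theory Submission
  imports Defs
begin

text \<open>For \<open>\<delta> \<cdot> \<parallel>Q\<parallel> \<le> 1\<close> the operator \<open>I + \<delta>Q\<close> is a sublinear transition operator,
  hence nonexpansive and norm-decreasing. One step of length \<open>\<delta>\<close> differs from \<open>k\<close> steps of
  length \<open>\<delta>/k\<close> by at most \<open>(\<delta>\<parallel>Q\<parallel>)\<^sup>2 \<parallel>f\<parallel>\<close>, so nonexpansiveness makes the \<open>n\<close>-step and the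
  \<open>nk\<close>-step approximations differ by at most \<open>(t\<parallel>Q\<parallel>)\<^sup>2 \<parallel>f\<parallel> / n\<close>. Comparing \<open>n\<close> and
  \<open>m\<close> steps through \<open>nm\<close> steps bounds their difference by \<open>(t\<parallel>Q\<parallel>)\<^sup>2 (1/n + 1/m) \<parallel>f\<parallel>\<close>,
  and the properties of a transition operator pass to pointwise limits.\<close>

section \<open>Estimates for the supremum norm and the operator norms\<close>

lemma abs_apply_bfun_le: "\<bar>apply_bfun f x\<bar> \<le> norm f"
  unfolding norm_bfun_def by (rule cSUP_upper[OF UNIV_I bdd_above_abs_bfun])

lemma norm_bfun_least: "(\<And>x. \<bar>apply_bfun f x\<bar> \<le> b) \<Longrightarrow> norm f \<le> b"
  unfolding norm_bfun_def by (rule cSUP_least) auto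

lemma bdd_above_bfun: "bdd_above (range (apply_bfun f))"
  by (rule bdd_aboveI[of _ "norm f"]) (use abs_apply_bfun_le[of f] in \<open>auto simp: abs_le_iff\<close>)

lemma apply_bfun_le_SUP: "apply_bfun f x \<le> (SUP y. apply_bfun f y)"
  by (rule cSUP_upper[OF UNIV_I bdd_above_bfun])

lemma SUP_bfun_le_norm: "(SUP y. apply_bfun f y) \<le> norm f"
  by (rule cSUP_least) (use abs_apply_bfun_le[of f] in \<open>auto simp: abs_le_iff\<close>)

lemma const_bfun_0: "const_bfun 0 = 0"
  by (rule bfun_eqI) (simp add: const_bfun.rep_eq zero_bfun.rep_eq)

lemma bounded_operatorI:
  assumes "\<And>f. norm (A f) \<le> c * norm f"
  shows "bounded_operator A"
proof -
  have "op_norm_s A \<le> ereal c"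
    by (rule op_norm_s_least) (simp add: assms divide_le_eq)
  then show ?thesis
    by (auto simp: bounded_operator_def)
qed

text \<open>\<open>op_norm_s\<close> ranges over nonzero functions only and does not see
  \<open>A 0\<close>, so a purely multiplicative bound requires \<open>A 0 = 0\<close>.\<close>

lemma bounded_operatorE:
  fixes A :: "'a bfun \<Rightarrow> 'a bfun"
  assumes "bounded_operator A" and "A 0 = 0"
  obtains c where "0 \<le> c" "\<And>f. norm (A f) \<le> c * norm f"
proof
  let ?c = "real_of_ereal (op_norm_s A)"
  show "0 \<le> ?c"
    by (simp add: op_norm_s_nonneg real_of_ereal_pos)
  fix f :: "'a bfun"
  show "norm (A f) \<le> ?c * norm f"
  proof (cases "f = 0")
    case False
    have "ereal (norm (A f) / norm f) \<le> ereal ?c"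
      using op_norm_s_upper[OF False, of A] by (simp add: op_norm_s_ereal assms)
    then show ?thesis
      using False by (simp add: divide_le_eq)
  qed (simp add: assms)
qed

text \<open>At \<open>f = 0\<close> the hypothesis forces \<open>A 0 = B 0\<close>, so only the
  \<open>op_norm_s\<close> part of the distance remains.\<close>

lemma op_dist_le:
  assumes "\<And>f. norm (A f - B f) \<le> c * norm f"
  shows "op_dist A B \<le> c"
proof -
  let ?D = "\<lambda>f. A f - B f"
  have "op_norm_s ?D \<le> ereal c"
    by (rule op_norm_s_least) (simp add: assms divide_le_eq)
  moreover have "bounded_operator ?D"
    using assms by (rule bounded_operatorI)
  ultimately have "ereal (real_of_ereal (op_norm_s ?D)) \<le> ereal c"
    by (simp add: op_norm_s_ereal)
  moreover have "norm (?D 0) = 0"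
    using assms[of 0] by simp
  ultimately show ?thesis
    by (simp add: op_dist_def op_norm_b_def)
qed


subsection \<open>Transition operators\<close>

context
  fixes T :: "'a bfun \<Rightarrow> 'a bfun"
  assumes T: "sublinear_transition_operator T"
begin

lemma transition_scaleR: "0 \<le> c \<Longrightarrow> T (c *\<^sub>R f) = c *\<^sub>R T f"
  and transition_add: "apply_bfun (T (f + g)) x \<le> apply_bfun (T f) x + apply_bfun (T g) x"
  and transition_le_SUP: "apply_bfun (T f) x \<le> (SUP y. apply_bfun f y)"
  using T by (auto simp: sublinear_transition_operator_def)

lemma transition_zero: "T 0 = 0"
  using transition_scaleR[of 0 0] by simp

text \<open>Subadditivity applied to \<open>f = (f - g) + g\<close> replaces the missing linearity
  of \<open>T\<close>.\<close>

lemma transition_diff_le: "apply_bfun (T f) x - apply_bfun (T g) x \<le> norm (f - g)"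
  using transition_add[of "f - g" g x] transition_le_SUP[of "f - g" x] SUP_bfun_le_norm[of "f - g"]
  by simp

lemma transition_nonexpansive: "norm (T f - T g) \<le> norm (f - g)"
  using transition_diff_le[of f _ g] transition_diff_le[of g _ f]
  by (intro norm_bfun_least) (simp add: minus_bfun.rep_eq norm_minus_commute abs_le_iff)

lemma transition_norm_le: "norm (T f) \<le> norm f"
  using transition_nonexpansive[of f 0] by (simp add: transition_zero)

lemma transition_SUP_mono: "(SUP y. apply_bfun (T f) y) \<le> (SUP y. apply_bfun f y)"
  by (rule cSUP_least) (simp_all add: transition_le_SUP)

end

lemma transition_mono:
  assumes T: "sublinear_transition_operator T" and le: "\<And>x. apply_bfun f x \<le> apply_bfun g x"
  shows "apply_bfun (T f) x \<le> apply_bfun (T g) x"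
proof -
  have "apply_bfun (T (f - g)) x \<le> (SUP y. apply_bfun (f - g) y)"
    using T by (rule transition_le_SUP)
  also have "\<dots> \<le> 0"
    by (rule cSUP_least) (simp_all add: minus_bfun.rep_eq le)
  finally show ?thesis
    using transition_add[OF T, of "f - g" g x] by simp
qed

text \<open>Subadditivity of the inner operator is only an inequality; monotonicity of the outer one
  carries it through.\<close>

lemma transition_comp:
  assumes S: "sublinear_transition_operator S" and T: "sublinear_transition_operator T"
  shows "sublinear_transition_operator (S \<circ> T)"
  unfolding sublinear_transition_operator_def
proof (intro conjI allI impI)
  fix f g :: "'a bfun" and x and c :: real
  show "(S \<circ> T) (c *\<^sub>R f) = c *\<^sub>R (S \<circ> T) f" if "0 \<le> c"
    using that by (simp add: transition_scaleR[OF S] transition_scaleR[OF T])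
  have "apply_bfun (S (T (f + g))) x \<le> apply_bfun (S (T f + T g)) x"
    by (rule transition_mono[OF S]) (simp add: plus_bfun.rep_eq transition_add[OF T])
  then show "apply_bfun ((S \<circ> T) (f + g)) x \<le> apply_bfun ((S \<circ> T) f) x + apply_bfun ((S \<circ> T) g) x"
    using transition_add[OF S, of "T f" "T g" x] by simp
  show "apply_bfun ((S \<circ> T) f) x \<le> (SUP y. apply_bfun f y)"
    using transition_le_SUP[OF S, of "T f" x] transition_SUP_mono[OF T, of f] by simp
qed

lemma transition_id: "sublinear_transition_operator id"
  by (simp add: sublinear_transition_operator_def plus_bfun.rep_eq apply_bfun_le_SUP)

lemma transition_funpow: "sublinear_transition_operator T \<Longrightarrow> sublinear_transition_operator (T ^^ n)"
  by (induction n) (simp_all add: transition_id transition_comp del: id_apply)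

text \<open>Each defining property is an equation or non-strict inequality between finitely many
  values or against a fixed supremum, so pointwise convergence preserves it.\<close>

lemma transition_limit:
  assumes T: "\<forall>\<^sub>F n in sequentially. sublinear_transition_operator (T n)"
    and lim: "\<And>f x. (\<lambda>n. apply_bfun (T n f) x) \<longlonglongrightarrow> apply_bfun (L f) x"
  shows "sublinear_transition_operator L"
  unfolding sublinear_transition_operator_def
proof (intro conjI allI impI)
  fix f g :: "'a bfun" and x and c :: real
  show "L (c *\<^sub>R f) = c *\<^sub>R L f" if c: "0 \<le> c"
  proof (rule bfun_eqI)
    fix y
    have "(\<lambda>n. c * apply_bfun (T n f) y) \<longlonglongrightarrow> c * apply_bfun (L f) y"
      by (intro tendsto_intros lim)
    then have "(\<lambda>n. apply_bfun (T n (c *\<^sub>R f)) y) \<longlonglongrightarrow> c * apply_bfun (L f) y"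
    proof (rule Lim_transform_eventually)
      show "\<forall>\<^sub>F n in sequentially. c * apply_bfun (T n f) y = apply_bfun (T n (c *\<^sub>R f)) y"
        using T by eventually_elim (simp add: transition_scaleR c scaleR_bfun.rep_eq)
    qed
    with lim[of "c *\<^sub>R f" y] show "apply_bfun (L (c *\<^sub>R f)) y = apply_bfun (c *\<^sub>R L f) y"
      by (simp add: scaleR_bfun.rep_eq LIMSEQ_unique)
  qed
  show "apply_bfun (L (f + g)) x \<le> apply_bfun (L f) x + apply_bfun (L g) x"
  proof (rule tendsto_le[OF sequentially_bot])
    show "(\<lambda>n. apply_bfun (T n f) x + apply_bfun (T n g) x)
        \<longlonglongrightarrow> apply_bfun (L f) x + apply_bfun (L g) x"
      by (intro tendsto_intros lim)
    show "\<forall>\<^sub>F n in sequentially.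
        apply_bfun (T n (f + g)) x \<le> apply_bfun (T n f) x + apply_bfun (T n g) x"
      using T by eventually_elim (rule transition_add)
  qed (rule lim)
  show "apply_bfun (L f) x \<le> (SUP y. apply_bfun f y)"
  proof (rule tendsto_upperbound[OF lim])
    show "\<forall>\<^sub>F n in sequentially. apply_bfun (T n f) x \<le> (SUP y. apply_bfun f y)"
      using T by eventually_elim (rule transition_le_SUP)
  qed simp
qed

text \<open>Telescoping: nonexpansiveness of \<open>S\<close> keeps each one-step error from growing, while \<open>T\<close>
  keeps the functions to which the one-step estimate is applied bounded by \<open>\<parallel>f\<parallel>\<close>.\<close>

lemma transition_funpow_diff:
  assumes S: "sublinear_transition_operator S" and T: "sublinear_transition_operator T"
    and step: "\<And>f. norm (S f - T f) \<le> e * norm f" and e: "0 \<le> e"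
  shows "norm ((S ^^ n) f - (T ^^ n) f) \<le> real n * e * norm f"
proof (induction n)
  case (Suc n)
  have "norm ((S ^^ Suc n) f - (T ^^ Suc n) f)
      \<le> norm (S ((S ^^ n) f) - S ((T ^^ n) f)) + norm (S ((T ^^ n) f) - T ((T ^^ n) f))"
    using norm_triangle_ineq[of "S ((S ^^ n) f) - S ((T ^^ n) f)" "S ((T ^^ n) f) - T ((T ^^ n) f)"]
    by simp
  also have "norm (S ((S ^^ n) f) - S ((T ^^ n) f)) \<le> real n * e * norm f"
    using transition_nonexpansive[OF S] Suc.IH by (rule order_trans)
  also have "norm (S ((T ^^ n) f) - T ((T ^^ n) f)) \<le> e * norm f"
    using step mult_left_mono[OF transition_norm_le[OF transition_funpow[OF T]] e]
    by (rule order_trans)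
  finally show ?case
    by (simp add: algebra_simps)
qed simp


subsection \<open>Bounded rate operators\<close>

locale bounded_rate =
  fixes Q :: "'a bfun \<Rightarrow> 'a bfun" and M :: real
  assumes rate: "sublinear_rate_operator Q"
    and M_nonneg: "0 \<le> M"
    and norm_le: "norm (Q f) \<le> M * norm f"
begin

lemma scaleR: "0 \<le> c \<Longrightarrow> Q (c *\<^sub>R f) = c *\<^sub>R Q f"
  and add: "apply_bfun (Q (f + g)) x \<le> apply_bfun (Q f) x + apply_bfun (Q g) x"
  and const: "Q (const_bfun c) = 0"
  using rate by (auto simp: sublinear_rate_operator_def)

lemma max_principle:
  "(SUP y. apply_bfun f y) = apply_bfun f x \<Longrightarrow> 0 \<le> apply_bfun f x \<Longrightarrow> apply_bfun (Q f) x \<le> 0"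
  using rate by (auto simp: sublinear_rate_operator_def)

lemma diff_le: "apply_bfun (Q f) x - apply_bfun (Q g) x \<le> M * norm (f - g)"
  using add[of "f - g" g x] abs_apply_bfun_le[of "Q (f - g)" x] norm_le[of "f - g"] by simp

text \<open>For a nonlinear \<open>Q\<close> a bound on \<open>norm (Q f)\<close> alone would not
  give this; subadditivity does, through \<open>diff_le\<close> in both directions.\<close>

lemma lipschitz: "norm (Q f - Q g) \<le> M * norm (f - g)"
  using diff_le[of f _ g] diff_le[of g _ f]
  by (intro norm_bfun_least) (simp add: minus_bfun.rep_eq norm_minus_commute abs_le_iff)

text \<open>The supremum of \<open>f\<close> need not be attained, so \<open>max_principle\<close> is applied to the
  modification \<open>h\<close> of \<open>f - sup f\<close> that vanishes at \<open>x\<close>; it changes \<open>f - sup f\<close> by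
  \<open>sup f - f x\<close> in norm.\<close>

lemma le_SUP_diff: "apply_bfun (Q f) x \<le> M * ((SUP y. apply_bfun f y) - apply_bfun f x)"
proof -
  define s where "s = (SUP y. apply_bfun f y)"
  define g where "g = f + const_bfun (- s)"
  define d where "d = Bfun (\<lambda>y. if y = x then apply_bfun f x - s else 0)"
  define h where "h = g - d"
  have fs: "apply_bfun f y \<le> s" for y
    unfolding s_def by (rule apply_bfun_le_SUP)
  have d: "apply_bfun d y = (if y = x then apply_bfun f x - s else 0)" for y
    unfolding d_def by (subst Bfun_inverse) (auto simp: bounded_iff intro: exI[of _ "\<bar>apply_bfun f x - s\<bar>"])
  have g: "apply_bfun g y = apply_bfun f y - s" for y
    by (simp add: g_def plus_bfun.rep_eq const_bfun.rep_eq)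
  have h: "apply_bfun h y = (if y = x then 0 else apply_bfun f y - s)" for y
    by (simp add: h_def minus_bfun.rep_eq d g)
  have "(SUP y. apply_bfun h y) = apply_bfun h x"
    by (intro cSup_eq_maximum) (auto simp: h fs)
  then have "apply_bfun (Q h) x \<le> 0"
    by (intro max_principle) (simp_all add: h)
  moreover have "norm d \<le> s - apply_bfun f x"
    by (rule norm_bfun_least) (use fs[of x] in \<open>simp add: d\<close>)
  then have "M * norm d \<le> M * (s - apply_bfun f x)"
    by (simp add: M_nonneg mult_left_mono)
  moreover have "apply_bfun (Q d) x \<le> M * norm d"
    using abs_apply_bfun_le[of "Q d" x] norm_le[of d] by simp
  moreover have "apply_bfun (Q g) x \<le> apply_bfun (Q h) x + apply_bfun (Q d) x"
    using add[of h d x] by (simp add: h_def)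
  moreover have "f = g + const_bfun s"
    by (rule bfun_eqI) (simp add: plus_bfun.rep_eq const_bfun.rep_eq g)
  \<comment> \<open>\<open>Q\<close> kills constants, so undoing the shift by \<open>s\<close> costs
    nothing.\<close>
  then have "apply_bfun (Q f) x \<le> apply_bfun (Q g) x"
    using add[of g "const_bfun s" x] by (simp add: const zero_bfun.rep_eq)
  ultimately show ?thesis
    unfolding s_def by linarith
qed

abbreviation euler_step :: "real \<Rightarrow> 'a bfun \<Rightarrow> 'a bfun"
  where "euler_step \<delta> \<equiv> \<lambda>f. f + \<delta> *\<^sub>R Q f"

text \<open>By \<open>le_SUP_diff\<close> a step raises the value at \<open>x\<close> by at most
  \<open>\<delta> * M\<close> times its gap to the supremum; with
  \<open>\<delta> * M \<le> 1\<close> it cannot overshoot.\<close>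

lemma transition_euler_step:
  assumes \<delta>: "0 \<le> \<delta>" "\<delta> * M \<le> 1"
  shows "sublinear_transition_operator (euler_step \<delta>)"
  unfolding sublinear_transition_operator_def
proof (intro conjI allI impI)
  fix f g :: "'a bfun" and x and c :: real
  show "euler_step \<delta> (c *\<^sub>R f) = c *\<^sub>R euler_step \<delta> f" if "0 \<le> c"
    using that by (simp add: scaleR algebra_simps)
  show "apply_bfun (euler_step \<delta> (f + g)) x
      \<le> apply_bfun (euler_step \<delta> f) x + apply_bfun (euler_step \<delta> g) x"
    using mult_left_mono[OF add[of f g x] \<delta>(1)]
    by (simp add: plus_bfun.rep_eq scaleR_bfun.rep_eq algebra_simps)
  let ?d = "(SUP y. apply_bfun f y) - apply_bfun f x"
  have "\<delta> * apply_bfun (Q f) x \<le> \<delta> * (M * ?d)"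
    by (intro mult_left_mono le_SUP_diff \<delta>)
  also have "\<dots> \<le> ?d"
    using mult_right_mono[OF \<delta>(2), of ?d] apply_bfun_le_SUP[of f x] by (simp add: mult.assoc)
  finally show "apply_bfun (euler_step \<delta> f) x \<le> (SUP y. apply_bfun f y)"
    by (simp add: plus_bfun.rep_eq scaleR_bfun.rep_eq)
qed

section \<open>Error of iterated Euler steps\<close>

context
  fixes \<delta> :: real
  assumes \<delta>: "0 \<le> \<delta>" "\<delta> * M \<le> 1"
begin

text \<open>Telescoping against the powers of the identity, with one-step error
  \<open>\<delta> * M\<close>.\<close>

lemma euler_step_funpow_diff: "norm ((euler_step \<delta> ^^ k) f - f) \<le> real k * (\<delta> * M) * norm f"
proof -
  have "norm ((euler_step \<delta> ^^ k) f - (id ^^ k) f) \<le> real k * (\<delta> * M) * norm f"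
  proof (rule transition_funpow_diff)
    fix g :: "'a bfun"
    show "norm (euler_step \<delta> g - id g) \<le> \<delta> * M * norm g"
      using mult_left_mono[OF norm_le[of g] \<delta>(1)] by (simp add: \<delta> mult.assoc)
  qed (simp_all add: transition_euler_step transition_id \<delta> M_nonneg del: id_apply)
  then show ?thesis
    by simp
qed

text \<open>Step \<open>j\<close> evaluates \<open>Q\<close> at the \<open>j\<close>-th iterate
  instead of at \<open>f\<close>. The iterate has drifted by at most
  \<open>j * \<delta> * M * norm f\<close>, and the Lipschitz bound contributes another
  \<open>\<delta> * M\<close>; the sum of \<open>j\<close> over \<open>j < k\<close> is at most
  \<open>k^2\<close>.\<close>

lemma euler_step_funpow_linearization:
  "norm (f + (real k * \<delta>) *\<^sub>R Q f - (euler_step \<delta> ^^ k) f) \<le> (real k * (\<delta> * M))\<^sup>2 * norm f"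
proof (induction k)
  case (Suc k)
  let ?g = "(euler_step \<delta> ^^ k) f"
  let ?e = "f + (real k * \<delta>) *\<^sub>R Q f - ?g"
  \<comment> \<open>The new error is the old one plus the effect of evaluating \<open>Q\<close> at
    \<open>?g\<close> rather than at \<open>f\<close>.\<close>
  have "f + (real (Suc k) * \<delta>) *\<^sub>R Q f - (euler_step \<delta> ^^ Suc k) f = ?e + \<delta> *\<^sub>R (Q f - Q ?g)"
    by (simp add: algebra_simps)
  then have "norm (f + (real (Suc k) * \<delta>) *\<^sub>R Q f - (euler_step \<delta> ^^ Suc k) f)
      = norm (?e + \<delta> *\<^sub>R (Q f - Q ?g))"
    by (rule arg_cong)
  also have "\<dots> \<le> norm ?e + \<delta> * norm (Q f - Q ?g)"
    using norm_triangle_ineq[of ?e "\<delta> *\<^sub>R (Q f - Q ?g)"] by (simp add: \<delta>)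
  also have "\<dots> \<le> (real k * (\<delta> * M))\<^sup>2 * norm f + \<delta> * (M * (real k * (\<delta> * M) * norm f))"
  proof (intro add_mono Suc.IH mult_left_mono \<delta>)
    have "norm (Q f - Q ?g) \<le> M * norm (?g - f)"
      using lipschitz[of f ?g] by (simp add: norm_minus_commute)
    also have "\<dots> \<le> M * (real k * (\<delta> * M) * norm f)"
      by (intro mult_left_mono euler_step_funpow_diff M_nonneg)
    finally show "norm (Q f - Q ?g) \<le> M * (real k * (\<delta> * M) * norm f)" .
  qed
  also have "(real k * (\<delta> * M))\<^sup>2 * norm f + \<delta> * (M * (real k * (\<delta> * M) * norm f))
      = ((real k)\<^sup>2 + real k) * ((\<delta> * M)\<^sup>2 * norm f)"
    by (simp add: power2_eq_square algebra_simps)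
  also have "\<dots> \<le> (real (Suc k))\<^sup>2 * ((\<delta> * M)\<^sup>2 * norm f)"
    by (rule mult_right_mono) (simp add: power2_eq_square algebra_simps, simp)
  finally show ?case
    by (simp only: power_mult_distrib mult.assoc)
qed simp

end

section \<open>Convergence of the Euler operators\<close>

context
  fixes t :: real
  assumes t: "0 \<le> t"
begin

lemma euler_step_small: "0 < n \<Longrightarrow> t * M \<le> real n \<Longrightarrow> 0 \<le> t / real n \<and> t / real n * M \<le> 1"
  using t by (simp add: field_simps)

lemma transition_euler_operator:
  "0 < n \<Longrightarrow> t * M \<le> real n \<Longrightarrow> sublinear_transition_operator (euler_operator t Q n)"
  unfolding euler_operator_def
  using euler_step_small by (blast intro: transition_funpow transition_euler_step)

text \<open>There are \<open>n\<close> local errors of size \<open>(t * M / n)^2\<close>. The bound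
  is independent of \<open>k\<close>, so it applies to a common refinement of any two step
  sizes.\<close>

lemma euler_operator_refine:
  assumes n: "0 < n" "t * M \<le> real n" and k: "0 < k"
  shows "norm (euler_operator t Q n f - euler_operator t Q (n * k) f) \<le> (t * M)\<^sup>2 / real n * norm f"
proof -
  have "real n \<le> real (n * k)"
    using k by (intro of_nat_mono) simp
  then have nk: "0 < n * k" "t * M \<le> real (n * k)"
    using n k by (simp, linarith)
  note small = euler_step_small[OF n] euler_step_small[OF nk]
  let ?S = "euler_step (t / real n)" and ?T = "euler_step (t / real (n * k)) ^^ k"
  have "norm (?S f - ?T f) \<le> (t * M / real n)\<^sup>2 * norm f" for f
  proof -
    have "real k * (t / real (n * k)) = t / real n" "real k * (t / real (n * k) * M) = t * M / real n"
      using k by simp_all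
    then show ?thesis
      using euler_step_funpow_linearization[of "t / real (n * k)" f k] small
      by (simp only:)
  qed
  then have "norm ((?S ^^ n) f - (?T ^^ n) f) \<le> real n * (t * M / real n)\<^sup>2 * norm f"
    using small by (intro transition_funpow_diff transition_euler_step transition_funpow) auto
  also have "real n * (t * M / real n)\<^sup>2 = (t * M)\<^sup>2 / real n"
    using n by (simp add: power2_eq_square)
  finally show ?thesis
    by (simp add: euler_operator_def funpow_mult mult.commute)
qed

lemma euler_operator_diff:
  assumes n: "0 < n" "t * M \<le> real n" and m: "0 < m" "t * M \<le> real m"
  shows "norm (euler_operator t Q n f - euler_operator t Q m f)
    \<le> ((t * M)\<^sup>2 / real n + (t * M)\<^sup>2 / real m) * norm f"
proof -
  let ?E = "\<lambda>n. euler_operator t Q n f"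
  have "norm (?E n - ?E m) \<le> norm (?E n - ?E (n * m)) + norm (?E m - ?E (n * m))"
    by (metis norm_triangle_ineq4 diff_diff_eq2 diff_add_cancel)
  then show ?thesis
    using euler_operator_refine[OF n m(1), of f] euler_operator_refine[OF m n(1), of f]
    by (simp add: algebra_simps)
qed

text \<open>Completeness of the reals gives a limit at each point; the rate does not depend on the
  point and so becomes a norm estimate.\<close>

lemma euler_operator_converges:
  obtains L where "\<And>n f. 0 < n \<Longrightarrow> t * M \<le> real n \<Longrightarrow>
      norm (euler_operator t Q n f - L f) \<le> (t * M)\<^sup>2 / real n * norm f"
    and "\<And>f x. (\<lambda>n. apply_bfun (euler_operator t Q n f) x) \<longlonglongrightarrow> apply_bfun (L f) x"
proof -
  let ?C = "(t * M)\<^sup>2"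
  let ?E = "\<lambda>n f x. apply_bfun (euler_operator t Q n f) x"
  define N where "N = Suc (nat \<lceil>t * M\<rceil>)"
  have N: "0 < n" "t * M \<le> real n" if "N \<le> n" for n
    using that by (auto simp: N_def) linarith
  have diff: "\<bar>?E n f x - ?E m f x\<bar> \<le> (?C / real n + ?C / real m) * norm f"
    if "0 < n" "t * M \<le> real n" "N \<le> m" for n m f x
    using abs_apply_bfun_le[of "euler_operator t Q n f - euler_operator t Q m f" x]
      euler_operator_diff[OF that(1,2) N[OF that(3)], of f]
    by (simp add: minus_bfun.rep_eq)
  have "convergent (\<lambda>n. ?E n f x)" for f x
  proof -
    have "Cauchy (\<lambda>n. ?E n f x)"
    proof (rule metric_CauchyI)
      fix e :: real assume e: "0 < e"
      have "(\<lambda>n. ?C / real n * norm f) \<longlonglongrightarrow> 0"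
        by (auto intro!: tendsto_mult_left_zero lim_const_over_n)
      then have "\<forall>\<^sub>F n in sequentially. ?C / real n * norm f < e / 2"
        by (rule order_tendstoD) (use e in simp)
      then obtain K where K: "?C / real n * norm f < e / 2" if "K \<le> n" for n
        by (auto simp: eventually_sequentially)
      show "\<exists>K. \<forall>m\<ge>K. \<forall>n\<ge>K. dist (?E m f x) (?E n f x) < e"
      proof (intro exI allI impI)
        fix m n assume mn: "max N K \<le> m" "max N K \<le> n"
        then have "\<bar>?E m f x - ?E n f x\<bar> \<le> (?C / real m + ?C / real n) * norm f"
          by (intro diff N) auto
        then show "dist (?E m f x) (?E n f x) < e"
          using K[of m] K[of n] mn unfolding dist_real_def distrib_right by linarith
      qed
    qed
    then show ?thesis
      by (rule Cauchy_convergent)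
  qed
  then have lim: "(\<lambda>n. ?E n f x) \<longlonglongrightarrow> lim (\<lambda>n. ?E n f x)" for f x
    by (simp add: convergent_LIMSEQ_iff)
  have le: "\<bar>?E n f x - lim (\<lambda>n. ?E n f x)\<bar> \<le> ?C / real n * norm f"
    if "0 < n" "t * M \<le> real n" for n f x
  \<comment> \<open>Let \<open>m\<close> tend to infinity in \<open>diff\<close> with
    \<open>n\<close> fixed; the term \<open>?C / real m\<close> vanishes.\<close>
  proof (rule tendsto_le[OF sequentially_bot])
    have "(\<lambda>m. (?C / real n + ?C / real m) * norm f) \<longlonglongrightarrow> (?C / real n + 0) * norm f"
      by (intro tendsto_intros lim_const_over_n)
    then show "(\<lambda>m. (?C / real n + ?C / real m) * norm f) \<longlonglongrightarrow> ?C / real n * norm f"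
      by simp
    show "(\<lambda>m. \<bar>?E n f x - ?E m f x\<bar>) \<longlonglongrightarrow> \<bar>?E n f x - lim (\<lambda>n. ?E n f x)\<bar>"
      by (intro tendsto_intros lim)
    show "\<forall>\<^sub>F m in sequentially. \<bar>?E n f x - ?E m f x\<bar> \<le> (?C / real n + ?C / real m) * norm f"
      using diff[OF that] by (auto simp: eventually_sequentially)
  qed
  define L where "L f = Bfun (\<lambda>x. lim (\<lambda>n. ?E n f x))" for f
  have L: "apply_bfun (L f) x = lim (\<lambda>n. ?E n f x)" for f x
  proof -
    \<comment> \<open>The limit stays within a fixed distance of the \<open>N\<close>-th
      approximation, uniformly in \<open>x\<close>, so it is bounded and \<open>Bfun\<close> returns
      it unchanged.\<close>
    have "\<bar>lim (\<lambda>n. ?E n f x)\<bar> \<le> ?C / real N * norm f + norm (euler_operator t Q N f)" for x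
      using le[OF N[OF order_refl], of f x] abs_apply_bfun_le[of "euler_operator t Q N f" x]
      by linarith
    then have "bounded (range (\<lambda>x. lim (\<lambda>n. ?E n f x)))"
      by (auto simp: bounded_iff)
    then show ?thesis
      unfolding L_def by (subst Bfun_inverse) simp_all
  qed
  show ?thesis
  proof
    show "norm (euler_operator t Q n f - L f) \<le> ?C / real n * norm f"
      if "0 < n" "t * M \<le> real n" for n f
      by (rule norm_bfun_least) (simp only: minus_bfun.rep_eq L le that)
    show "(\<lambda>n. ?E n f x) \<longlonglongrightarrow> apply_bfun (L f) x" for f x
      using lim by (simp add: L)
  qed
qed

text \<open>Covers every \<open>n\<close>, also the small ones for which a step need not be a
  transition operator: the Cauchy property requires all terms to lie in the space. For
  \<open>n = 0\<close> the quotient \<open>t / real n\<close> is 0.\<close>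

lemma bounded_operator_euler: "bounded_operator (euler_operator t Q n)"
proof -
  let ?P = "euler_step (t / real n)" and ?c = "1 + t / real n * M"
  have c: "0 \<le> ?c"
    using t M_nonneg by simp
  have step: "norm (?P f) \<le> ?c * norm f" for f
    using norm_triangle_ineq[of f "(t / real n) *\<^sub>R Q f"] mult_left_mono[OF norm_le[of f], of "t / real n"] t
    by (simp add: algebra_simps)
  have "norm ((?P ^^ k) f) \<le> ?c ^ k * norm f" for k f
  proof (induction k)
    case (Suc k)
    show ?case
      using order_trans[OF step mult_left_mono[OF Suc.IH c]] by (simp add: mult.assoc)
  qed simp
  then show ?thesis
    unfolding euler_operator_def by (rule bounded_operatorI)
qed

end

end

theorem theorem13:
  fixes Q :: "'a::countable bfun \<Rightarrow> 'a bfun" and t :: real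
  assumes "sublinear_rate_operator Q"
    and "bounded_operator Q"
    and "0 \<le> t"
  shows "bounded_ops.MCauchy (euler_operator t Q) \<and>
    limitin bounded_ops.mtopology (euler_operator t Q) (exp_operator t Q) sequentially \<and>
    sublinear_transition_operator (exp_operator t Q)"
proof -
  have "Q (const_bfun 0) = 0"
    using assms(1) unfolding sublinear_rate_operator_def by blast
  then have "Q 0 = 0"
    by (simp add: const_bfun_0)
  with assms(2) obtain M where "0 \<le> M" "\<And>f. norm (Q f) \<le> M * norm f"
    using bounded_operatorE by blast
  then interpret bounded_rate Q M
    using assms(1) by unfold_locales
  let ?E = "euler_operator t Q"
  obtain L where le: "\<And>n f. 0 < n \<Longrightarrow> t * M \<le> real n \<Longrightarrow> norm (?E n f - L f) \<le> (t * M)\<^sup>2 / real n * norm f"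
    and lim: "\<And>f x. (\<lambda>n. apply_bfun (?E n f) x) \<longlonglongrightarrow> apply_bfun (L f) x"
    using euler_operator_converges[OF assms(3)] by blast
  have large: "\<forall>\<^sub>F n in sequentially. 0 < n \<and> t * M \<le> real n"
    using eventually_gt_at_top[of 0] eventually_ge_at_top[of "nat \<lceil>t * M\<rceil>"]
    by eventually_elim linarith
  have "\<forall>\<^sub>F n in sequentially. sublinear_transition_operator (?E n)"
    using large by eventually_elim (simp add: transition_euler_operator assms(3))
  then have L: "sublinear_transition_operator L"
    using lim by (rule transition_limit)
  then have bounded_L: "bounded_operator L"
    by (intro bounded_operatorI[of _ 1]) (simp add: transition_norm_le)
  have bounded_E: "bounded_operator (?E n)" for n
    using assms(3) by (rule bounded_operator_euler)
  have "limitin bounded_ops.mtopology ?E L sequentially"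
    unfolding bounded_ops.limitin_metric
  proof (intro conjI allI impI)
    fix e :: real assume "0 < e"
    then have "\<forall>\<^sub>F n in sequentially. (t * M)\<^sup>2 / real n < e"
      by (rule order_tendstoD(2)[OF lim_const_over_n])
    with large show "\<forall>\<^sub>F n in sequentially. ?E n \<in> Collect bounded_operator \<and> op_dist (?E n) L < e"
      by eventually_elim (use op_dist_le[OF le] in \<open>auto simp: bounded_E intro: le_less_trans\<close>)
  qed (simp add: bounded_L)
  moreover from this have "exp_operator t Q = L"
    unfolding exp_operator_def
    by (intro the_equality) (auto intro: bounded_ops.limitin_metric_unique)
  \<comment> \<open>A convergent sequence is Cauchy once all its terms are bounded
    operators.\<close>
  moreover have "bounded_ops.MCauchy ?E"
    using calculation(1) by (intro bounded_ops.convergent_imp_MCauchy) (auto simp: bounded_E)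
  ultimately show ?thesis
    using L by simp
qed

end
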